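(* Let $A,B,C_1,\dots,C_p,D_1,\dots,D_q\in\mathbb{C}^{r\times r}$ be such that each $D_j+kI$, $1\le j\le q$, is invertible for all integers $k\ge 0$, $A$ and $B-I$ are positive stable, and $AB=BA$. Then $$zA\frac{d}{dz}\,{}_pR_q(A,B;z)={}_pR_q(A,B-I;z)-(B-I)\,{}_pR_q(A,B;z),$$ where the parameters $C_1,\dots,C_p,D_1,\dots,D_q$ are the same in all three functions.
   Context: A matrix is positive stable if all its eigenvalues have positive real part. The Pochhammer symbol of $M\in\mathbb{C}^{r\times r}$ is $(M)_0=I$, $(M)_n=M(M+I)\cdots(M+(n-1)I)$ for $n\ge 1$. $\Gamma^{-1}(M)$ denotes the entire function $1/\Gamma$ applied to $M$. For matrices $A,B,C_1,\dots,C_p,D_1,\dots,D_q\in\mathbb{C}^{r\times r}$ such that each $D_j+kI$ is invertible for all integers $k\ge 0$, one defines $${}_pR_q(A,B;z)=\sum_{n\ge 0}\Gamma^{-1}(nA+B)\,(C_1)_n\cdots(C_p)_n\,(D_1)_n^{-1}\cdots(D_q)_n^{-1}\,\frac{z^n}{n!},$$ with products taken in the written order. *)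

theory Defs
  imports "HOL-Analysis.Analysis"
begin

definition eigenvalue_of :: "complex ^ 'r ^ 'r \<Rightarrow> complex \<Rightarrow> bool" where
  "eigenvalue_of M \<mu> \<longleftrightarrow> (\<exists>v. v \<noteq> 0 \<and> M *v v = \<mu> *s v)"

definition positive_stable :: "complex ^ 'r ^ 'r \<Rightarrow> bool" where
  "positive_stable M \<longleftrightarrow> (\<forall>\<mu>. eigenvalue_of M \<mu> \<longrightarrow> 0 < Re \<mu>)"

(* The class operations times and power on vectors are componentwise, and vector_scalar_mult on a
   matrix takes a row as its scalar; none of them is the matrix operation needed here. *)

definition cscale :: "complex \<Rightarrow> complex ^ 'r ^ 'r \<Rightarrow> complex ^ 'r ^ 'r" where
  "cscale c M = map_matrix ((*) c) M"

primrec mpow :: "complex ^ 'r ^ 'r \<Rightarrow> nat \<Rightarrow> complex ^ 'r ^ 'r" where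
  "mpow M 0 = mat 1"
| "mpow M (Suc n) = mpow M n ** M"

primrec mpochhammer :: "complex ^ 'r ^ 'r \<Rightarrow> nat \<Rightarrow> complex ^ 'r ^ 'r" where
  "mpochhammer M 0 = mat 1"
| "mpochhammer M (Suc n) = mpochhammer M n ** (M + mat (of_nat n))"

(* An entire function is applied to a matrix through its Taylor series at 0. *)

definition mrGamma :: "complex ^ 'r ^ 'r \<Rightarrow> complex ^ 'r ^ 'r" where
  "mrGamma M = (\<Sum>n. cscale ((deriv ^^ n) rGamma 0 / fact n) (mpow M n))"

definition mprod_list :: "(complex ^ 'r ^ 'r) list \<Rightarrow> complex ^ 'r ^ 'r" where
  "mprod_list Ms = foldr (**) Ms (mat 1)"

(* The parameters C_1, ..., C_p and D_1, ..., D_q are passed as lists; p and q are their lengths. *)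

definition pRq_coeff ::
  "complex ^ 'r ^ 'r \<Rightarrow> complex ^ 'r ^ 'r \<Rightarrow> (complex ^ 'r ^ 'r) list \<Rightarrow> (complex ^ 'r ^ 'r) list
    \<Rightarrow> nat \<Rightarrow> complex ^ 'r ^ 'r" where
  "pRq_coeff A B Cs Ds n =
     cscale (1 / fact n)
       (mrGamma (cscale (of_nat n) A + B)
          ** mprod_list (map (\<lambda>C. mpochhammer C n) Cs)
          ** mprod_list (map (\<lambda>D. matrix_inv (mpochhammer D n)) Ds))"

definition pRq ::
  "complex ^ 'r ^ 'r \<Rightarrow> complex ^ 'r ^ 'r \<Rightarrow> (complex ^ 'r ^ 'r) list \<Rightarrow> (complex ^ 'r ^ 'r) list
    \<Rightarrow> complex \<Rightarrow> complex ^ 'r ^ 'r" where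
  "pRq A B Cs Ds z = (\<Sum>n. cscale (z ^ n) (pRq_coeff A B Cs Ds n))"

(* The type of matrices is not a complex normed field, so the complex derivative of a
   matrix-valued function is taken entrywise. *)

definition mdifferentiable_at :: "(complex \<Rightarrow> complex ^ 'r ^ 'r) \<Rightarrow> complex \<Rightarrow> bool" where
  "mdifferentiable_at F z \<longleftrightarrow> (\<forall>i j. (\<lambda>w. F w $ i $ j) field_differentiable (at z))"

definition mderiv :: "(complex \<Rightarrow> complex ^ 'r ^ 'r) \<Rightarrow> complex \<Rightarrow> complex ^ 'r ^ 'r" where
  "mderiv F z = (\<chi> i j. deriv (\<lambda>w. F w $ i $ j) z)"

end

theory Submission
  imports Defs "HOL-Complex_Analysis.Cauchy_Integral_Formula"
begin

text \<open>
  The functional equation \<open>1/\<Gamma>(z) = z \<cdot> 1/\<Gamma>(z + 1)\<close> is an identity between power series, hence by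
  binomial rearrangement it also holds with a matrix in place of \<open>z\<close>. Applied to
  \<open>nA + B - I\<close>, it shows that the \<open>n\<close>-th coefficient of the series with parameter \<open>B - I\<close> is
  \<open>nA + B - I\<close> times the one with parameter \<open>B\<close>. The factor \<open>n\<close> is produced by \<open>z d/dz\<close>.
\<close>

section \<open>Re-expansion of entire functions\<close>

text \<open>Convergence at the strictly larger point \<open>|r| + 1\<close> forces absolute
  convergence at \<open>|r|\<close>.\<close>

lemma summable_norm_powser_entire:
  fixes a :: "nat \<Rightarrow> complex"
  assumes "\<And>z. (\<lambda>n. a n * z ^ n) sums f z"
  shows "summable (\<lambda>n. norm (a n) * \<bar>r\<bar> ^ n)"
proof -
  have "summable (\<lambda>n. a n * of_real (\<bar>r\<bar> + 1) ^ n)"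
    using assms sums_summable by blast
  from powser_insidea[OF this, of "of_real \<bar>r\<bar>"] show ?thesis
    by (simp add: norm_mult norm_power)
qed

lemma powser_entire_unique:
  fixes a b :: "nat \<Rightarrow> complex"
  assumes a: "\<And>z. (\<lambda>n. a n * z ^ n) sums f z" and b: "\<And>z. (\<lambda>n. b n * z ^ n) sums f z"
  shows "a = b"
proof -
  have "conv_radius a = \<infinity>" "conv_radius b = \<infinity>"
    by (rule conv_radius_inftyI'', use a b sums_summable in blast)+
  moreover have "eval_fps (Abs_fps a) z = eval_fps (Abs_fps b) z" for z
    using a b by (simp add: eval_fps_def sums_iff)
  ultimately have "Abs_fps a = Abs_fps b"
    by (intro eval_fps_eqD) (auto simp: fps_conv_radius_def)
  then show ?thesis
    by (simp add: Abs_fps_inject)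
qed

text \<open>The family \<open>a n * (n choose k) * m k\<close> is absolutely summable, because the
  binomial theorem bounds its row norms by \<open>norm (a n) * (L + 1) ^ n\<close>; so it may be
  summed by rows or by columns. Only a geometric bound on \<open>m\<close> is asked for, so that
  \<open>m k\<close> can be \<open>z ^ k\<close> or an entry of the k-th power of a matrix.\<close>

lemma powser_binomial_rearrange:
  fixes a m :: "nat \<Rightarrow> complex"
  assumes a: "\<And>r::real. summable (\<lambda>n. norm (a n) * \<bar>r\<bar> ^ n)"
    and m: "\<And>k. norm (m k) \<le> L ^ k" and L: "0 \<le> L"
  shows "(\<lambda>k. (\<Sum>n. a n * of_nat (n choose k)) * m k) sums
         (\<Sum>n. a n * (\<Sum>k\<le>n. of_nat (n choose k) * m k))"
proof -
  define f where "f = (\<lambda>(n, k). a n * of_nat (n choose k) * m k)"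
  define S where "S n = a n * (\<Sum>k\<le>n. of_nat (n choose k) * m k)" for n
  define b where "b k = (\<Sum>n. a n * of_nat (n choose k))" for k
  have row: "((\<lambda>k. f (n, k)) has_sum S n) UNIV" for n
    unfolding S_def f_def
    by (rule has_sum_finite_neutralI[of "{..n}"]) (auto simp: sum_distrib_left mult_ac)
  have nrow: "((\<lambda>k. norm (f (n, k))) has_sum (\<Sum>k\<le>n. norm (f (n, k)))) UNIV" for n
    by (rule has_sum_finite_neutralI[of "{..n}"]) (auto simp: f_def)
  have bound: "(\<Sum>k\<le>n. norm (f (n, k))) \<le> norm (a n) * \<bar>L + 1\<bar> ^ n" for n
  proof -
    have "(\<Sum>k\<le>n. norm (f (n, k))) \<le> (\<Sum>k\<le>n. norm (a n) * (of_nat (n choose k) * L ^ k))"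
      by (intro sum_mono) (auto simp: f_def norm_mult mult.assoc intro!: mult_left_mono m)
    also have "\<dots> = norm (a n) * \<bar>L + 1\<bar> ^ n"
      using L binomial_ring[of L 1 n] by (simp add: sum_distrib_left)
    finally show ?thesis .
  qed
  have "summable (\<lambda>n. \<Sum>k\<le>n. norm (f (n, k)))"
    by (rule summable_comparison_test'[OF a[of "L + 1"]]) (use bound in \<open>auto simp: sum_nonneg\<close>)
  then have "(\<lambda>n. \<Sum>k\<le>n. norm (f (n, k))) summable_on UNIV"
    by (intro summable_nonneg_imp_summable_on) (auto simp: sum_nonneg)
  then have f: "(\<lambda>x. norm (f x)) summable_on (UNIV \<times> UNIV)"
    unfolding Infinite_Sum.abs_summable_on_Sigma_iff
    using nrow infsumI[OF nrow] has_sum_imp_summable[OF nrow] by (auto simp: sum_nonneg)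
  then obtain T where T: "(f has_sum T) (UNIV \<times> UNIV)"
    using Infinite_Sum.abs_summable_summable[OF f] unfolding summable_on_def by blast
  have "(S has_sum T) UNIV"
    using has_sum_SigmaD[OF T] row by blast
  then have ST: "suminf S = T"
    using has_sum_imp_sums sums_unique by metis
  have T': "((\<lambda>(k, n). f (n, k)) has_sum T) (UNIV \<times> UNIV)"
    using T unfolding has_sum_swap[of f] .
  have "((\<lambda>n. a n * of_nat (n choose k)) has_sum b k) UNIV" for k
    unfolding b_def
  proof (rule norm_summable_imp_has_sum)
    show "summable (\<lambda>n. norm (a n * of_nat (n choose k)))"
    \<comment> \<open>The radius 2 comes from \<open>n choose k <= 2 ^ n\<close>.\<close>
    proof (rule summable_comparison_test'[OF a[of 2]])
      fix n
      have "real (n choose k) \<le> 2 ^ n"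
        using binomial_le_pow2[of n k] of_nat_le_iff[where 'a = real] by fastforce
      then show "norm (norm (a n * of_nat (n choose k))) \<le> norm (a n) * \<bar>2\<bar> ^ n"
        by (simp add: norm_mult mult_left_mono)
    qed
    then show "(\<lambda>n. a n * of_nat (n choose k)) sums (\<Sum>n. a n * of_nat (n choose k))"
      by (simp add: summable_norm_cancel summable_sums)
  qed
  then have col: "((\<lambda>n. case (k, n) of (k, n) \<Rightarrow> f (n, k)) has_sum b k * m k) UNIV" for k
    unfolding f_def by (auto intro!: has_sum_cmult_left)
  have "((\<lambda>k. b k * m k) has_sum T) UNIV"
    using has_sum_SigmaD[OF T' col] .
  then show ?thesis
    using ST has_sum_imp_sums unfolding S_def b_def by metis
qed

section \<open>Matrix power series\<close>

lemma cscale_nth [simp]: "cscale c M $ i $ j = c * M $ i $ j"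
  by (simp add: cscale_def map_matrix_def)

lemma matrix_mult_nth: "(M ** N) $ i $ j = (\<Sum>l\<in>UNIV. M $ i $ l * N $ l $ j)"
  by (simp add: matrix_matrix_mult_def)

lemma matrix_sums_iff:
  fixes f :: "nat \<Rightarrow> complex ^ 'c ^ 'r"
  shows "f sums S \<longleftrightarrow> (\<forall>i j. (\<lambda>n. f n $ i $ j) sums (S $ i $ j))"
proof
  assume "\<forall>i j. (\<lambda>n. f n $ i $ j) sums (S $ i $ j)"
  then show "f sums S"
    unfolding sums_def by (intro vec_tendstoI) simp
qed (simp add: sums_vec_nth)

lemma mpow_Suc_left: "mpow M (Suc n) = M ** mpow M n"
  by (induction n) (simp_all flip: matrix_mul_assoc)

text \<open>Supplies the geometric bound required by
  \<open>powser_binomial_rearrange\<close>.\<close>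

lemma mpow_entry_bound:
  fixes M :: "complex ^ 'r ^ 'r"
  obtains L where "0 \<le> L" "\<And>n i j. norm (mpow M n $ i $ j) \<le> L ^ n"
proof
  \<comment> \<open>An entry of a product is a sum of \<open>CARD('r)\<close> products of entries,
    and every entry of \<open>M\<close> has modulus at most \<open>norm M\<close>.\<close>
  define L where "L = real CARD('r) * norm M"
  show L0: "0 \<le> L"
    by (simp add: L_def)
  show "norm (mpow M n $ i $ j) \<le> L ^ n" for n i j
  proof (induction n arbitrary: i j)
    case 0
    then show ?case by (simp add: mat_def)
  next
    case (Suc n)
    have M: "norm (M $ i $ j) \<le> norm M" for i j
      by (rule order_trans[OF Finite_Cartesian_Product.norm_nth_le Finite_Cartesian_Product.norm_nth_le])
    have "norm (mpow M (Suc n) $ i $ j) \<le> (\<Sum>l\<in>(UNIV::'r set). L ^ n * norm M)"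
      unfolding mpow.simps matrix_mult_nth
      by (intro sum_norm_le) (auto simp: norm_mult L0 intro!: mult_mono Suc M)
    then show ?case
      by (simp add: L_def mult_ac)
  qed
qed

lemma sum_binomial_Suc:
  fixes g :: "nat \<Rightarrow> 'a::comm_semiring_1"
  shows "(\<Sum>k\<le>Suc n. of_nat (Suc n choose k) * g k) =
         (\<Sum>k\<le>n. of_nat (n choose k) * g k) + (\<Sum>k\<le>n. of_nat (n choose k) * g (Suc k))"
proof -
  \<comment> \<open>The added term has binomial coefficient zero; splitting off \<open>g 0\<close>
    then gives the range needed for Pascal's rule.\<close>
  have "(\<Sum>k\<le>n. of_nat (n choose k) * g k) = (\<Sum>k\<le>Suc n. of_nat (n choose k) * g k)"
    by (simp add: binomial_eq_0)
  also have "\<dots> = g 0 + (\<Sum>k\<le>n. of_nat (n choose Suc k) * g (Suc k))"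
    by (subst sum.atMost_Suc_shift) simp
  finally show ?thesis
    by (subst sum.atMost_Suc_shift) (simp add: sum.distrib algebra_simps)
qed

text \<open>The identity matrix commutes with \<open>N\<close>, so the binomial theorem holds for
  \<open>N + mat 1\<close>; the induction applies Pascal's rule to scalar entries.\<close>

lemma mpow_plus_one_nth:
  "mpow (N + mat 1) n $ i $ j = (\<Sum>k\<le>n. of_nat (n choose k) * mpow N k $ i $ j)"
proof (induction n arbitrary: i j)
  case 0
  then show ?case by simp
next
  case (Suc n)
  have "mpow (N + mat 1) (Suc n) $ i $ j =
        (mpow (N + mat 1) n ** N) $ i $ j + mpow (N + mat 1) n $ i $ j"
    by (simp add: matrix_add_ldistrib)
  also have "(mpow (N + mat 1) n ** N) $ i $ j =
        (\<Sum>k\<le>n. of_nat (n choose k) * mpow N (Suc k) $ i $ j)"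
    unfolding matrix_mult_nth mpow.simps Suc sum_distrib_left sum_distrib_right mult.assoc
    by (rule sum.swap)
  finally show ?case
    by (simp only: sum_binomial_Suc Suc add.commute)
qed

section \<open>The reciprocal Gamma function of a matrix\<close>

abbreviation rGamma_coeff :: "nat \<Rightarrow> complex" where
  "rGamma_coeff n \<equiv> (deriv ^^ n) rGamma 0 / fact n"

lemma rGamma_sums: "(\<lambda>n. rGamma_coeff n * z ^ n) sums rGamma z"
  using holomorphic_power_series[OF holomorphic_rGamma, of z 0 "norm z + 1"] by simp

lemmas summable_norm_rGamma = summable_norm_powser_entire[OF rGamma_sums]

text \<open>Entries of powers grow at most geometrically and the Taylor series converges absolutely
  at every radius, so the \<open>suminf\<close> in \<open>mrGamma\<close> is a true limit.\<close>

lemma mrGamma_sums: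
  "(\<lambda>n. rGamma_coeff n * mpow M n $ i $ j) sums (mrGamma M $ i $ j)"
proof -
  obtain L where L: "0 \<le> L" "\<And>n i j. norm (mpow M n $ i $ j) \<le> L ^ n"
    using mpow_entry_bound by blast
  have "summable (\<lambda>n. rGamma_coeff n * mpow M n $ i $ j)" for i j
  proof (rule summable_comparison_test'[OF summable_norm_rGamma[of L]])
    show "norm (rGamma_coeff n * mpow M n $ i $ j) \<le> norm (rGamma_coeff n) * \<bar>L\<bar> ^ n" for n
      unfolding norm_mult using L by (intro mult_left_mono) auto
  qed
  then have "(\<lambda>n. cscale (rGamma_coeff n) (mpow M n)) sums
             (\<chi> i j. \<Sum>n. rGamma_coeff n * mpow M n $ i $ j)"
    by (simp add: matrix_sums_iff summable_sums)
  then have "(\<lambda>n. cscale (rGamma_coeff n) (mpow M n)) sums mrGamma M"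
    unfolding mrGamma_def by (simp add: sums_iff)
  then show ?thesis
    by (simp add: matrix_sums_iff)
qed

text \<open>Taylor coefficients at 0 of 1/Gamma(z + 1), found by expanding each
  \<open>(z + 1) ^ n\<close>.\<close>

definition rGamma_shift_coeff :: "nat \<Rightarrow> complex" where
  "rGamma_shift_coeff k = (\<Sum>n. rGamma_coeff n * of_nat (n choose k))"

lemma rGamma_shift_sums: "(\<lambda>k. rGamma_shift_coeff k * z ^ k) sums rGamma (z + 1)"
proof -
  have "(\<lambda>k. rGamma_shift_coeff k * z ^ k) sums
        (\<Sum>n. rGamma_coeff n * (\<Sum>k\<le>n. of_nat (n choose k) * z ^ k))"
    unfolding rGamma_shift_coeff_def
    by (rule powser_binomial_rearrange[OF summable_norm_rGamma, where L = "norm z"])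
       (auto simp: norm_power)
  also have "(\<lambda>n. \<Sum>k\<le>n. of_nat (n choose k) * z ^ k) = (\<lambda>n. (z + 1) ^ n)"
    by (simp add: binomial_ring)
  then have "(\<Sum>n. rGamma_coeff n * (\<Sum>k\<le>n. of_nat (n choose k) * z ^ k)) = rGamma (z + 1)"
    using rGamma_sums[of "z + 1"] by (metis (no_types, lifting) sums_unique suminf_cong)
  finally show ?thesis .
qed

text \<open>Comparison of coefficients in 1/Gamma(z) = z * 1/Gamma(z + 1): the factor z moves the
  index up by one and leaves constant term 0.\<close>

lemma rGamma_coeff_rec: "rGamma_coeff k = (case k of 0 \<Rightarrow> 0 | Suc n \<Rightarrow> rGamma_shift_coeff n)"
proof -
  have "(\<lambda>k. (case k of 0 \<Rightarrow> 0 | Suc n \<Rightarrow> rGamma_shift_coeff n) * z ^ k) sums rGamma z" for z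
  proof -
    have "(\<lambda>k. rGamma_shift_coeff k * z ^ Suc k) sums rGamma z"
      using sums_mult[OF rGamma_shift_sums[of z], of z] by (simp add: rGamma_plus1 mult_ac)
    then show ?thesis
      using sums_Suc[of "\<lambda>k. (case k of 0 \<Rightarrow> 0 | Suc n \<Rightarrow> rGamma_shift_coeff n) * z ^ k"] by simp
  qed
  from powser_entire_unique[OF rGamma_sums this] show ?thesis
    by (rule fun_cong)
qed

text \<open>Rearrangement with \<open>m k\<close> an entry of the k-th power of \<open>N\<close>.
  The coefficients are those of the scalar function, which carries the scalar recurrence over to
  matrices.\<close>

lemma mrGamma_shift_sums:
  "(\<lambda>k. rGamma_shift_coeff k * mpow N k $ i $ j) sums (mrGamma (N + mat 1) $ i $ j)"
proof -
  obtain L where "0 \<le> L" "\<And>n i j. norm (mpow N n $ i $ j) \<le> L ^ n"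
    using mpow_entry_bound by blast
  then show ?thesis
    using powser_binomial_rearrange[OF summable_norm_rGamma, of "\<lambda>k. mpow N k $ i $ j" L]
      mrGamma_sums[of "N + mat 1" i j]
    by (simp add: rGamma_shift_coeff_def mpow_plus_one_nth sums_iff)
qed

lemma mrGamma_plus_one: "N ** mrGamma (N + mat 1) = mrGamma N"
proof -
  have "(N ** mrGamma (N + mat 1)) $ i $ j = mrGamma N $ i $ j" for i j
  proof (rule sums_unique2)
    have "(\<lambda>k. \<Sum>l\<in>UNIV. N $ i $ l * (rGamma_shift_coeff k * mpow N k $ l $ j)) sums
          (N ** mrGamma (N + mat 1)) $ i $ j"
      unfolding matrix_mult_nth by (intro sums_sum sums_mult mrGamma_shift_sums)
    then show "(\<lambda>k. rGamma_shift_coeff k * mpow N (Suc k) $ i $ j) sums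
          (N ** mrGamma (N + mat 1)) $ i $ j"
      by (simp add: mpow_Suc_left matrix_mult_nth sum_distrib_left mult_ac del: mpow.simps)
    \<comment> \<open>The constant coefficient is 0, so the series of \<open>mrGamma N\<close> may
      start at index 1.\<close>
    show "(\<lambda>k. rGamma_shift_coeff k * mpow N (Suc k) $ i $ j) sums (mrGamma N $ i $ j)"
      using sums_Suc_iff[of "\<lambda>k. rGamma_coeff k * mpow N k $ i $ j" "mrGamma N $ i $ j"]
        mrGamma_sums[of N i j]
      unfolding rGamma_coeff_rec by (simp del: mpow.simps)
  qed
  then show ?thesis
    by (simp add: vec_eq_iff)
qed

section \<open>The contiguous relation\<close>

lemma cscale_mult_right: "M ** cscale c N = cscale c (M ** N)"
  by (simp add: vec_eq_iff matrix_mult_nth sum_distrib_left mult_ac)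

text \<open>The reciprocal Gamma factor stands leftmost, so \<open>mrGamma_plus_one\<close> puts the
  matrix factor in front of the whole coefficient.\<close>

lemma pRq_coeff_minus_one:
  "pRq_coeff A (B - mat 1) Cs Ds n = (cscale (of_nat n) A + (B - mat 1)) ** pRq_coeff A B Cs Ds n"
  using mrGamma_plus_one[of "cscale (of_nat n) A + (B - mat 1)"]
  by (simp add: pRq_coeff_def cscale_mult_right matrix_mul_assoc add.assoc)

lemma le_conv_radius_nth:
  fixes c :: "nat \<Rightarrow> complex ^ 'c ^ 'r"
  shows "conv_radius c \<le> conv_radius (\<lambda>n. c n $ i $ j)"
proof -
  have "norm (c n $ i $ j) \<le> norm (c n)" for n
    by (rule order_trans[OF Finite_Cartesian_Product.norm_nth_le Finite_Cartesian_Product.norm_nth_le])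
  then have "root n (norm (c n $ i $ j)) \<le> root n (norm (c n))" for n
    by (cases n) auto
  then have "limsup (\<lambda>n. ereal (root n (norm (c n $ i $ j)))) \<le> limsup (\<lambda>n. ereal (root n (norm (c n))))"
    by (intro Limsup_mono) simp
  \<comment> \<open>Inversion of extended reals is antitone only on nonnegative values.\<close>
  moreover have "0 \<le> limsup (\<lambda>n. ereal (root n (norm (c n $ i $ j))))"
    by (intro le_Limsup always_eventually allI)
      (auto simp: real_root_ge_zero zero_ereal_def simp del: ereal_eq_0)
  ultimately show ?thesis
    unfolding conv_radius_def by (intro ereal_inverse_antimono)
qed

text \<open>Convergence and differentiability belong to the conclusion, so that neither
  \<open>suminf\<close> nor \<open>deriv\<close> stands for a default value.\<close>

theorem theorem4p2:
  fixes A B :: "complex ^ 'r ^ 'r"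
    and Cs Ds :: "(complex ^ 'r ^ 'r) list"
    and z :: complex
  assumes "\<And>D k. D \<in> set Ds \<Longrightarrow> invertible (D + mat (of_nat k))"
    and "positive_stable A"
    and "positive_stable (B - mat 1)"
    and "A ** B = B ** A"
    and "ereal (norm z) < conv_radius (pRq_coeff A B Cs Ds)"
  shows "summable (\<lambda>n. cscale (z ^ n) (pRq_coeff A B Cs Ds n))
       \<and> summable (\<lambda>n. cscale (z ^ n) (pRq_coeff A (B - mat 1) Cs Ds n))
       \<and> mdifferentiable_at (pRq A B Cs Ds) z
       \<and> cscale z (A ** mderiv (pRq A B Cs Ds) z)
           = pRq A (B - mat 1) Cs Ds z - (B - mat 1) ** pRq A B Cs Ds z"
proof -
  define c where "c = pRq_coeff A B Cs Ds"
  define F where "F = pRq A B Cs Ds"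
  define F' where "F' = mderiv F z"
  \<comment> \<open>The claimed value of the function with parameter \<open>B - mat 1\<close>;
    showing that its series sums to \<open>X\<close> yields convergence and value together.\<close>
  define X where "X = cscale z (A ** F') + (B - mat 1) ** F z"
  have entry: "ereal (norm w) < conv_radius (\<lambda>n. c n $ i $ j)"
    if "ereal (norm w) < conv_radius c" for w :: complex and i j
    using that le_conv_radius_nth less_le_trans by blast
  have F_sums: "(\<lambda>n. cscale (w ^ n) (c n)) sums F w" if "ereal (norm w) < conv_radius c" for w
  proof -
    have "(\<lambda>n. cscale (w ^ n) (c n)) sums (\<chi> i j. \<Sum>n. c n $ i $ j * w ^ n)"
      using summable_in_conv_radius[OF entry[OF that]]
      by (simp add: matrix_sums_iff mult.commute summable_sums)
    then show ?thesis
      unfolding F_def pRq_def c_def by (simp add: sums_iff)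
  qed
  have z: "ereal (norm z) < conv_radius c"
    using assms(5) by (simp add: c_def)
  have deriv: "((\<lambda>w. F w $ i $ j) has_field_derivative (\<Sum>n. diffs (\<lambda>n. c n $ i $ j) n * z ^ n)) (at z)"
    for i j
  \<comment> \<open>Each entry of \<open>F\<close> agrees with its power series on the whole open
    disc, so termwise differentiation applies; \<open>eball\<close> also covers infinite
    radius.\<close>
  proof (rule has_field_derivative_transform_within_open[OF has_field_derivative_powser[OF entry[OF z]]])
    show "open (eball 0 (conv_radius c) :: complex set)" "z \<in> eball 0 (conv_radius c)"
      using z by auto
    fix w :: complex assume "w \<in> eball 0 (conv_radius c)"
    then have "(\<lambda>n. cscale (w ^ n) (c n)) sums F w"
      by (intro F_sums) simp
    then show "(\<Sum>n. c n $ i $ j * w ^ n) = F w $ i $ j"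
      by (simp add: matrix_sums_iff sums_iff mult.commute)
  qed
  then have diff: "mdifferentiable_at F z"
    unfolding mdifferentiable_at_def field_differentiable_def by blast
  have zF': "(\<lambda>n. of_nat n * (z ^ n * c n $ i $ j)) sums (z * F' $ i $ j)" for i j
  proof -
    have "summable (\<lambda>n. diffs (\<lambda>n. c n $ i $ j) n * z ^ n)"
      using summable_fps[of z "fps_deriv (Abs_fps (\<lambda>n. c n $ i $ j))"] entry[OF z, of i j]
        fps_conv_radius_deriv[of "Abs_fps (\<lambda>n. c n $ i $ j)"]
      by (auto simp: diffs_def fps_conv_radius_def)
    from sums_mult[OF diffs_equiv[OF this], of z]
    have "(\<lambda>n. z * (of_nat n * c n $ i $ j * z ^ (n - Suc 0))) sums (z * F' $ i $ j)"
      using DERIV_imp_deriv[OF deriv] by (simp add: F'_def mderiv_def)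
    \<comment> \<open>At \<open>n = 0\<close> the exponent is truncated, but the factor
      \<open>n\<close> makes both sides zero.\<close>
    moreover have "z * (of_nat n * c n $ i $ j * z ^ (n - Suc 0)) = of_nat n * (z ^ n * c n $ i $ j)" for n
      by (cases n) auto
    ultimately show ?thesis by simp
  qed
  have "(\<lambda>n. cscale (z ^ n) (pRq_coeff A (B - mat 1) Cs Ds n)) sums X"
    unfolding matrix_sums_iff
  proof (intro allI)
    fix i j
    \<comment> \<open>The factor \<open>nA + (B - I)\<close> is split: the part \<open>nA\<close>
      sums to \<open>A\<close> times \<open>z F'\<close>, the rest to \<open>B - I\<close> times
      \<open>F z\<close>.\<close>
    have "(\<lambda>n. (\<Sum>l\<in>UNIV. A $ i $ l * (of_nat n * (z ^ n * c n $ l $ j))) +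
               (\<Sum>l\<in>UNIV. (B - mat 1) $ i $ l * cscale (z ^ n) (c n) $ l $ j)) sums
          ((\<Sum>l\<in>UNIV. A $ i $ l * (z * F' $ l $ j)) + (\<Sum>l\<in>UNIV. (B - mat 1) $ i $ l * F z $ l $ j))"
      using F_sums[OF z] unfolding matrix_sums_iff
      by (intro sums_add sums_sum sums_mult zF') auto
    then show "(\<lambda>n. cscale (z ^ n) (pRq_coeff A (B - mat 1) Cs Ds n) $ i $ j) sums (X $ i $ j)"
      unfolding pRq_coeff_minus_one X_def c_def[symmetric]
      by (simp add: matrix_mult_nth sum_distrib_left ring_distribs sum.distrib sum_subtractf mult_ac)
  qed
  then have "summable (\<lambda>n. cscale (z ^ n) (pRq_coeff A (B - mat 1) Cs Ds n))"
    and "pRq A (B - mat 1) Cs Ds z = X"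
    by (simp_all add: pRq_def sums_iff)
  moreover have "summable (\<lambda>n. cscale (z ^ n) (pRq_coeff A B Cs Ds n))"
    using F_sums[OF z] by (simp add: c_def sums_iff)
  ultimately show ?thesis
    using diff by (simp add: X_def F'_def F_def)
qed

end
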